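(* Let $n$ be a positive integer and suppose $k$ is a positive integer such that $k \ge n/3 + 1$. Then there exists $A \in M_n$ such that $\Lambda_k(A) = \emptyset$.
   Context: $M_n$ denotes the algebra of $n \times n$ complex matrices. For $A \in M_n$ and a positive integer $k$, the rank-$k$ numerical range of $A$ is $$\Lambda_k(A) = \{\lambda \in \mathbb{C} : X^*AX = \lambda I_k \text{ for some } n \times k \text{ complex matrix } X \text{ with } X^*X = I_k\},$$ where $X^*$ is the conjugate transpose of $X$ and $I_k$ is the $k \times k$ identity matrix. *)

theory Defs
  imports "Jordan_Normal_Form.Schur_Decomposition"
begin

(* mat_adjoint is the library's conjugate transpose. *)
definition rank_numerical_range :: "nat \<Rightarrow> complex mat \<Rightarrow> complex set" where
  "rank_numerical_range k A =
     {l :: complex. \<exists>X \<in> carrier_mat (dim_row A) k.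
            mat_adjoint X * X = 1\<^sub>m k \<and>
            mat_adjoint X * A * X = l \<cdot>\<^sub>m 1\<^sub>m k}"

end

theory Submission
  imports Defs
begin

text \<open>
  The idea is to make \<open>A\<close> diagonal with diagonal entries from three non-collinear values, each
  repeated fewer than \<open>k\<close> times; this is possible because \<open>n \<le> 3 (k - 1)\<close>.  Suppose that \<open>X\<close>
  witnesses \<open>l \<in> \<Lambda>\<^sub>k(A)\<close>.  The range of \<open>X\<close> has dimension \<open>k\<close>, so it contains a unit vector
  whose coordinates vanish on any prescribed set of fewer than \<open>k\<close> positions.  The quadratic form of
  \<open>A\<close> equals \<open>l\<close> on every unit vector of the range; hence \<open>l\<close> is a convex combination of the
  diagonal entries at the remaining positions (lemma \<open>diagonal_rank_range_convex_combination\<close>).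
  Discarding the positions of one of the three values at a time puts \<open>l\<close> on each of the three edges
  of a non-degenerate triangle, and these have no common point.

  The triangle used has the vertices \<open>0\<close>, \<open>1\<close> and \<open>\<i>\<close>, whose edges lie on the lines \<open>Re + Im = 1\<close>,
  \<open>Re = 0\<close> and \<open>Im = 0\<close>.
\<close>

text \<open>
  Fewer homogeneous linear equations than unknowns have a nontrivial solution: padded with zero rows,
  the system is square and singular.
\<close>

lemma underdetermined_system_nontrivial_solution:
  fixes us :: "'a :: field vec list"
  assumes carrier: "set us \<subseteq> carrier_vec k" and few: "length us < k"
  shows "\<exists>v \<in> carrier_vec k. v \<noteq> 0\<^sub>v k \<and> (\<forall>u \<in> set us. u \<bullet> v = 0)"
proof -
  define r where "r i = (if i < length us then us ! i else 0\<^sub>v k)" for i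
  define B where "B = mat\<^sub>r k k r"
  have r: "r i \<in> carrier_vec k" for i
    using carrier nth_mem by (force simp: r_def)
  have B: "B \<in> carrier_mat k k"
    by (simp add: B_def)
  have row_B: "row B i = r i" if "i < k" for i
    using that r by (simp add: B_def)
  have "B = mat\<^sub>r k k (\<lambda>i. if i = k - 1 then 0\<^sub>v k else r i)"
    using few by (auto simp: B_def r_def intro!: arg_cong[where f = "mat\<^sub>r k k"])
  then have "det B = 0"
    using det_row_0[of "k - 1" k r] few r by (simp add: Pi_def)
  then obtain v where v: "v \<in> carrier_vec k" "v \<noteq> 0\<^sub>v k" "B *\<^sub>v v = 0\<^sub>v k"
    using det_0_iff_vec_prod_zero_field[OF B] by auto
  have "u \<bullet> v = 0" if "u \<in> set us" for u
  proof -
    from that obtain i where i: "i < length us" "u = us ! i"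
      by (auto simp: in_set_conv_nth)
    then have "u \<bullet> v = (B *\<^sub>v v) $ i"
      using few B row_B[of i] by (simp add: r_def)
    also have "\<dots> = 0"
      using v(3) i few by simp
    finally show ?thesis .
  qed
  with v show ?thesis by blast
qed

lemma mat_adjoint_carrier:
  "X \<in> carrier_mat n k \<Longrightarrow> mat_adjoint X \<in> carrier_mat k n"
  by (auto simp: mat_adjoint_def)

lemma mat_adjoint_vec_cscalar_prod:
  fixes X :: "complex mat"
  assumes "X \<in> carrier_mat n k" "w \<in> carrier_vec n" "v \<in> carrier_vec k"
  shows "(mat_adjoint X *\<^sub>v w) \<bullet>c v = w \<bullet>c (X *\<^sub>v v)"
proof -
  have entry: "(mat_adjoint X *\<^sub>v w) $ a = (\<Sum>i<n. cnj (X $$ (i, a)) * w $ i)" if "a < k" for a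
    using assms that
    by (auto simp: mat_adjoint_def scalar_prod_def mat_of_rows_def lessThan_atLeast0
        intro!: sum.cong)
  have "(mat_adjoint X *\<^sub>v w) \<bullet>c v
      = (\<Sum>a<k. (\<Sum>i<n. cnj (X $$ (i, a)) * w $ i) * cnj (v $ a))"
    using assms
    by (auto simp: scalar_prod_def lessThan_atLeast0 entry[unfolded lessThan_atLeast0]
        simp del: index_mult_mat_vec intro!: sum.cong)
  also have "\<dots> = (\<Sum>a<k. \<Sum>i<n. w $ i * cnj (X $$ (i, a) * v $ a))"
    by (simp only: sum_distrib_right) (simp add: mult_ac)
  also have "\<dots> = (\<Sum>i<n. \<Sum>a<k. w $ i * cnj (X $$ (i, a) * v $ a))"
    by (rule sum.swap)
  also have "\<dots> = w \<bullet>c (X *\<^sub>v v)"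
    using assms
    by (auto simp: scalar_prod_def lessThan_atLeast0 sum_distrib_left intro!: sum.cong)
  finally show ?thesis .
qed

text \<open>
  If the compression of \<open>A\<close> to the columns of \<open>X\<close> is scalar, then so is its quadratic form on
  the range of \<open>X\<close>; for \<open>A = 1\<close> and \<open>l = 1\<close> this says that \<open>X\<close> is an isometry.
\<close>

lemma quadratic_form_of_scalar_compression:
  fixes A X :: "complex mat"
  assumes A: "A \<in> carrier_mat n n" and X: "X \<in> carrier_mat n k" and v: "v \<in> carrier_vec k"
    and compression: "mat_adjoint X * A * X = l \<cdot>\<^sub>m 1\<^sub>m k"
  shows "(A *\<^sub>v (X *\<^sub>v v)) \<bullet>c (X *\<^sub>v v) = l * (v \<bullet>c v)"
proof -
  note X' = mat_adjoint_carrier[OF X]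
  have "(A *\<^sub>v (X *\<^sub>v v)) \<bullet>c (X *\<^sub>v v) = (mat_adjoint X *\<^sub>v (A *\<^sub>v (X *\<^sub>v v))) \<bullet>c v"
    using mat_adjoint_vec_cscalar_prod[OF X _ v, of "A *\<^sub>v (X *\<^sub>v v)"] A X v by simp
  also have "mat_adjoint X *\<^sub>v (A *\<^sub>v (X *\<^sub>v v)) = (mat_adjoint X * A * X) *\<^sub>v v"
    using A X X' v by (simp add: assoc_mult_mat_vec[of _ k n] assoc_mult_mat_vec[of _ k n _ k])
  also have "\<dots> = l \<cdot>\<^sub>v v"
    unfolding compression using v by (intro eq_vecI) auto
  also have "(l \<cdot>\<^sub>v v) \<bullet>c v = l * (v \<bullet>c v)"
    using v by simp
  finally show ?thesis .
qed

lemma quadratic_form_mat_diag: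
  fixes y :: "complex vec"
  assumes "y \<in> carrier_vec n"
  shows "(mat_diag n d *\<^sub>v y) \<bullet>c y = (\<Sum>i<n. of_real ((cmod (y $ i))\<^sup>2) * d i)"
proof -
  have "(mat_diag n d *\<^sub>v y) $ i = d i * y $ i" if "i < n" for i
    using assms that
    by (simp add: mat_diag_def scalar_prod_def if_distrib[of "\<lambda>x. x * _"] cong: if_cong)
  then show ?thesis
    using assms
    by (auto simp: scalar_prod_def lessThan_atLeast0 complex_norm_square[symmetric] mult_ac
        simp del: index_mult_mat_vec intro!: sum.cong)
qed

text \<open>
  The constraints \<open>y\<^sub>i = 0\<close> for \<open>i \<in> S\<close> are fewer than the dimension \<open>k\<close> of the range of \<open>X\<close>, so
  some nonzero \<open>y\<close> in the range satisfies them.  The weights are the squared moduli of the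
  coordinates of \<open>y\<close>, normalised.
\<close>

lemma diagonal_rank_range_convex_combination:
  assumes l: "l \<in> rank_numerical_range k (mat_diag n d)"
    and S: "S \<subseteq> {..<n}" and few: "card S < k"
  shows "\<exists>p :: nat \<Rightarrow> real. (\<forall>i \<in> S. p i = 0) \<and> (\<forall>i. 0 \<le> p i) \<and> (\<Sum>i<n. p i) = 1
            \<and> l = (\<Sum>i<n. of_real (p i) * d i)"
proof -
  have A: "mat_diag n d \<in> carrier_mat n n" by simp
  obtain X where X: "X \<in> carrier_mat n k" and isometry: "mat_adjoint X * X = 1\<^sub>m k"
    and compression: "mat_adjoint X * mat_diag n d * X = l \<cdot>\<^sub>m 1\<^sub>m k"
    using l by (auto simp: rank_numerical_range_def mat_diag_def)
  have "finite S" using S finite_subset by blast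
  moreover have "row X ` S \<subseteq> carrier_vec k" using X by auto
  ultimately obtain v where v: "v \<in> carrier_vec k" "v \<noteq> 0\<^sub>v k" and vanish: "\<forall>i \<in> S. row X i \<bullet> v = 0"
    using underdetermined_system_nontrivial_solution
      [of "map (row X) (sorted_list_of_set S)" k] few
    by auto
  define y where "y = X *\<^sub>v v"
  have y: "y \<in> carrier_vec n" using X v by (simp add: y_def)
  have y0: "y $ i = 0" if "i \<in> S" for i
    using that vanish S X by (auto simp: y_def)
  define N where "N = (\<Sum>i<n. (cmod (y $ i))\<^sup>2)"
  have "(1 :: complex) \<cdot>\<^sub>m 1\<^sub>m k = 1\<^sub>m k" by (intro eq_matI) auto
  then have "mat_adjoint X * 1\<^sub>m n * X = 1 \<cdot>\<^sub>m 1\<^sub>m k"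
    using isometry mat_adjoint_carrier[OF X] by simp
  from quadratic_form_of_scalar_compression[OF _ X v(1) this]
  have "v \<bullet>c v = y \<bullet>c y"
    using y by (simp add: y_def)
  also have "\<dots> = of_real N"
    using quadratic_form_mat_diag[OF y, of "\<lambda>_. 1"] y by (simp add: N_def)
  finally have norm_v: "v \<bullet>c v = of_real N" .
  then have N0: "N \<noteq> 0"
    using v conjugate_square_eq_0_vec[OF v(1)] by auto
  have form: "(\<Sum>i<n. of_real ((cmod (y $ i))\<^sup>2) * d i) = l * of_real N"
    using quadratic_form_of_scalar_compression[OF A X v(1) compression]
      quadratic_form_mat_diag[OF y, of d] norm_v by (simp add: y_def)
  define p where "p i = (cmod (y $ i))\<^sup>2 / N" for i
  have "(\<Sum>i<n. p i) = 1"
    using N0 by (simp add: p_def N_def flip: sum_divide_distrib)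
  moreover have "(\<Sum>i<n. of_real (p i) * d i) = l"
    using form N0 by (simp add: p_def flip: sum_divide_distrib)
  moreover have "0 \<le> p i" for i
    by (simp add: p_def N_def sum_nonneg)
  moreover have "p i = 0" if "i \<in> S" for i
    using y0[OF that] by (simp add: p_def)
  ultimately show ?thesis by metis
qed

text \<open>
  Giving weight zero to the positions off a line leaves a convex combination of points on it, which
  stays on the line.
\<close>

corollary diagonal_rank_range_on_line:
  assumes l: "l \<in> rank_numerical_range k (mat_diag n d)"
    and few: "card {i. i < n \<and> a * Re (d i) + b * Im (d i) \<noteq> c} < k"
  shows "a * Re l + b * Im l = c"
proof -
  let ?S = "{i. i < n \<and> a * Re (d i) + b * Im (d i) \<noteq> c}"
  obtain p :: "nat \<Rightarrow> real" where p0: "\<forall>i \<in> ?S. p i = 0" and p1: "(\<Sum>i<n. p i) = 1"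
    and lp: "l = (\<Sum>i<n. of_real (p i) * d i)"
    using diagonal_rank_range_convex_combination[OF l _ few] by auto
  have "a * Re l + b * Im l = (\<Sum>i<n. p i * (a * Re (d i) + b * Im (d i)))"
    by (simp add: lp sum_distrib_left sum.distrib algebra_simps)
  also have "\<dots> = (\<Sum>i<n. p i * c)"
    using p0 by (intro sum.cong) auto
  also have "\<dots> = c"
    using p1 by (simp flip: sum_distrib_right)
  finally show ?thesis .
qed

lemma card_residue_class_less:
  fixes n k m r :: nat
  assumes "n \<le> m * (k - 1)" "0 < k"
  shows "card {i. i < n \<and> i mod m = r} < k"
proof -
  have "{i. i < n \<and> i mod m = r} \<subseteq> (\<lambda>j. m * j + r) ` {..<k - 1}"
  proof
    fix i assume i: "i \<in> {i. i < n \<and> i mod m = r}"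
    then have "i div m < k - 1"
      using assms by (simp add: less_mult_imp_div_less mult.commute)
    moreover have "i = m * (i div m) + r"
      using i by auto
    ultimately show "i \<in> (\<lambda>j. m * j + r) ` {..<k - 1}" by blast
  qed
  then have "card {i. i < n \<and> i mod m = r} \<le> k - 1"
    using surj_card_le[of "{..<k - 1}"] by simp
  with assms show ?thesis by simp
qed

theorem theorem3:
  fixes n k :: nat
  assumes "n > 0" and "k > 0" and "real k \<ge> real n / 3 + 1"
  shows "\<exists>A \<in> carrier_mat n n. rank_numerical_range k A = {}"
proof -
  have n: "n \<le> 3 * (k - 1)" using assms by linarith
  define d :: "nat \<Rightarrow> complex" where
    "d i = (if i mod 3 = 0 then 0 else if i mod 3 = 1 then 1 else \<i>)" for i
  have "l \<notin> rank_numerical_range k (mat_diag n d)" for l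
  \<comment> \<open>Each of the three lines misses exactly one residue class of positions.\<close>
  proof
    assume l: "l \<in> rank_numerical_range k (mat_diag n d)"
    have few: "card {i. i < n \<and> i mod 3 = r} < k" for r
      using card_residue_class_less[OF n] assms by simp
    have mod3: "i mod 3 = 0 \<or> i mod 3 = 1 \<or> i mod 3 = 2" for i :: nat
      by linarith
    have "{i. i < n \<and> 1 * Re (d i) + 1 * Im (d i) \<noteq> 1} = {i. i < n \<and> i mod 3 = 0}"
      by (auto simp: d_def)
    from diagonal_rank_range_on_line[OF l, of 1 1 1, unfolded this, OF few]
    have "Re l + Im l = 1" by simp
    moreover have "{i. i < n \<and> 1 * Re (d i) + 0 * Im (d i) \<noteq> 0} = {i. i < n \<and> i mod 3 = 1}"
      by (auto simp: d_def)
    from diagonal_rank_range_on_line[OF l, of 1 0 0, unfolded this, OF few]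
    have "Re l = 0" by simp
    moreover have "{i. i < n \<and> 0 * Re (d i) + 1 * Im (d i) \<noteq> 0} = {i. i < n \<and> i mod 3 = 2}"
      using mod3 by (auto simp: d_def)
    from diagonal_rank_range_on_line[OF l, of 0 1 0, unfolded this, OF few]
    have "Im l = 0" by simp
    ultimately show False by simp
  qed
  then show ?thesis
    by (intro bexI[of _ "mat_diag n d"]) auto
qed

end
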